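(* Let $f:\mathbb{R}^n\to\mathbb{R}$ be differentiable, $\mu$-strongly convex and $L$-smooth, with condition number $C_f=L/\mu$. For $k\ge0$ let $$\alpha_k=\frac{\sqrt{C_f}}{\sqrt{C_f}+k/2},\qquad w_k=\frac{\alpha_k}{\sqrt{C_f}+\alpha_k}=\frac{1}{\sqrt{C_f}+1+k/2}.$$ Let $(x_k)_{k\ge0}$, $(v_k)_{k\ge0}$, $(y_k)_{k\ge0}$ be sequences in $\mathbb{R}^n$ with $y_k=(1-w_k)x_k+w_kv_k$ for all $k\ge 0$. Then the system $$x_{k+1}-x_k=w_k(v_k-x_k)-\alpha_k\frac{\nabla f(y_k)}{L},\qquad v_{k+1}-v_k=w_k(x_k-v_k)-\sqrt{C_f}\,\alpha_k\frac{\nabla f(y_k)}{L}\qquad(k\ge0)$$ is equivalent to the system $$x_{k+1}=y_k-\frac{\alpha_k}{L}\nabla f(y_k),\qquad y_{k+1}=x_{k+1}+\beta_k(x_{k+1}-x_k)+\gamma_k(y_k-x_k)\qquad(k\ge0)$$ where $$\beta_k=\frac{\sqrt{C_f}-1}{\sqrt{C_f}+1+(k+1)/2},\qquad \gamma_k=\frac{k}{2\sqrt{C_f}+k+3}.$$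
   Context: $f$ is $L$-smooth if $f(y)-f(x)+\nabla f(x)\cdot(x-y)\le \frac L2|x-y|^2$ for all $x,y$. $f$ is $\mu$-strongly convex ($\mu>0$) if $f(x)+\nabla f(x)\cdot(y-x)\le f(y)-\frac\mu2|x-y|^2$ for all $x,y$. *)

theory Defs
  imports "HOL-Analysis.Analysis"
begin

definition grad :: "('a::real_inner \<Rightarrow> real) \<Rightarrow> 'a \<Rightarrow> 'a" where
  "grad f x = (THE D. GDERIV f x :> D)"

lemma GDERIV_grad:
  fixes f :: "'a::euclidean_space \<Rightarrow> real"
  assumes "f differentiable (at x)"
  shows "GDERIV f x :> grad f x"
proof -
  obtain f' where f': "(f has_derivative f') (at x)"
    using assms by (auto simp: differentiable_def)
  interpret linear f' using f' by (rule has_derivative_linear)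
  define D where "D = (\<Sum>b\<in>Basis. f' b *\<^sub>R b)"
  have "f' h = h \<bullet> D" for h
  proof -
    have "f' h = f' (\<Sum>b\<in>Basis. (h \<bullet> b) *\<^sub>R b)"
      by (simp add: euclidean_representation)
    also have "\<dots> = (\<Sum>b\<in>Basis. (h \<bullet> b) * f' b)"
      by (simp add: sum scale)
    finally show ?thesis
      by (simp add: D_def inner_sum_right mult.commute)
  qed
  then have f'_eq: "f' = (\<lambda>h. h \<bullet> D)" by auto
  then have D: "GDERIV f x :> D"
    using f' by (simp add: gderiv_def)
  have "E = D" if "GDERIV f x :> E" for E
  proof -
    have "(\<lambda>h. h \<bullet> E) = (\<lambda>h. h \<bullet> D)"
      using that D unfolding gderiv_def by (rule has_derivative_unique)
    then have "(E - D) \<bullet> E = (E - D) \<bullet> D" by (rule fun_cong)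
    then have "(E - D) \<bullet> (E - D) = 0"
      by (simp add: inner_diff_right)
    then show ?thesis by simp
  qed
  with D show ?thesis
    unfolding grad_def by (rule theI)
qed

definition L_smooth :: "real \<Rightarrow> ('a::real_inner \<Rightarrow> real) \<Rightarrow> bool" where
  "L_smooth L f \<longleftrightarrow>
    (\<forall>x y. f y - f x + grad f x \<bullet> (x - y) \<le> L / 2 * (norm (x - y))\<^sup>2)"

definition strongly_convex :: "real \<Rightarrow> ('a::real_inner \<Rightarrow> real) \<Rightarrow> bool" where
  "strongly_convex \<mu> f \<longleftrightarrow> \<mu> > 0 \<and>
    (\<forall>x y. f x + grad f x \<bullet> (y - x) \<le> f y - \<mu> / 2 * (norm (x - y))\<^sup>2)"

end

theory Submission
  imports Defs
begin

text \<open>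
  Strong convexity and smoothness together force \<open>L \<ge> \<mu>\<close>, so \<open>C > 0\<close> and every \<open>w k\<close> is positive.
  The two descriptions of \<open>x (Suc k)\<close> agree because \<open>y k = x k + w k (v k - x k)\<close>.
  Given that update, write \<open>s = sqrt C\<close>; since \<open>1 / w k = s + 1 + k / 2\<close>, \<open>\<beta> k = (s - 1) w (Suc k)\<close> and
  \<open>\<gamma> k = (k / 2) w (Suc k)\<close>, the residual of the equation for \<open>y (Suc k)\<close> is \<open>w (Suc k)\<close> times the
  residual of the equation for \<open>v (Suc k)\<close>.
\<close>

text \<open>For a unit vector \<open>b\<close>, the gap
  \<open>f b - f 0 - grad f 0 \<bullet> b\<close> is at least \<mu>/2 by strong convexity and at
  most L/2 by smoothness.\<close>

lemma strongly_convex_L_smooth_le: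
  fixes f :: "'a::euclidean_space \<Rightarrow> real"
  assumes "strongly_convex \<mu> f" and "L_smooth L f"
  shows "\<mu> \<le> L"
proof -
  obtain b :: 'a where b: "b \<in> Basis"
    using nonempty_Basis by blast
  have "f 0 + grad f 0 \<bullet> (b - 0) \<le> f b - \<mu> / 2 * (norm (0 - b))\<^sup>2"
    using assms(1) unfolding strongly_convex_def by blast
  then have "f 0 + grad f 0 \<bullet> b \<le> f b - \<mu> / 2"
    using b by simp
  moreover have "f b - f 0 + grad f 0 \<bullet> (0 - b) \<le> L / 2 * (norm (0 - b))\<^sup>2"
    using assms(2) unfolding L_smooth_def by blast
  then have "f b - f 0 - grad f 0 \<bullet> b \<le> L / 2"
    using b by simp
  ultimately show ?thesis by linarith
qed

text \<open>Here \<open>a\<close> stands for k/2, \<open>d\<close> for the gradient step, and primes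
  for index k + 1. Since \<open>y' - x' = w' *\<^sub>R (v' - x')\<close>, the factor
  \<open>w'\<close> comes out of the left side; the relation \<open>w\<close> then trades
  \<open>a *\<^sub>R (y - x)\<close> for terms without \<open>a\<close>.\<close>

lemma momentum_residual:
  fixes x v x' v' d :: "'a::real_vector"
  assumes w: "w * (s + 1 + a) = 1"
    and y: "y = (1 - w) *\<^sub>R x + w *\<^sub>R v"
    and y': "y' = (1 - w') *\<^sub>R x' + w' *\<^sub>R v'"
    and x': "x' = y - d"
  shows "y' - (x' + (w' * (s - 1)) *\<^sub>R (x' - x) + (w' * a) *\<^sub>R (y - x))
    = w' *\<^sub>R ((v' - v) - (w *\<^sub>R (x - v) - s *\<^sub>R d))"
proof -
  have yx: "y - x = w *\<^sub>R (v - x)"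
    unfolding y by (simp add: algebra_simps)
  have aw: "a * w = 1 - w - s * w"
    using w by (simp add: algebra_simps)
  have "a *\<^sub>R (y - x) = (1 - w - s * w) *\<^sub>R (v - x)"
    unfolding yx scaleR_scaleR aw ..
  also have "\<dots> = (v - x) - (y - x) - s *\<^sub>R (y - x)"
    unfolding yx by (simp add: scaleR_left_diff_distrib)
  finally have ayx: "a *\<^sub>R (y - x) = (v - x) - (y - x) - s *\<^sub>R (y - x)" .
  have "y' - (x' + (w' * (s - 1)) *\<^sub>R (x' - x) + (w' * a) *\<^sub>R (y - x))
      = w' *\<^sub>R (v' - x' - (s - 1) *\<^sub>R (x' - x) - a *\<^sub>R (y - x))"
    unfolding y' by (simp add: algebra_simps)
  \<comment> \<open>After substituting \<open>x' = y - d\<close>, the multiples of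
    \<open>s *\<^sub>R (y - x)\<close> cancel and \<open>d\<close> keeps the coefficient
    \<open>s\<close>.\<close>
  also have "v' - x' - (s - 1) *\<^sub>R (x' - x) - a *\<^sub>R (y - x)
      = (v' - v) - (- (y - x) - s *\<^sub>R d)"
    unfolding ayx x' by (simp add: algebra_simps)
  also have "- (y - x) = w *\<^sub>R (x - v)"
    unfolding yx by (simp add: algebra_simps)
  finally show ?thesis .
qed

theorem proposition2p2:
  fixes f :: "real ^ 'n \<Rightarrow> real"
    and L \<mu> C :: real
    and \<alpha> w \<beta> \<gamma> :: "nat \<Rightarrow> real"
    and x v y :: "nat \<Rightarrow> real ^ 'n"
  assumes "\<And>z. f differentiable (at z)"
    and "strongly_convex \<mu> f"
    and "L_smooth L f"
    and "C = L / \<mu>"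
    and "\<And>k. \<alpha> k = sqrt C / (sqrt C + real k / 2)"
    and "\<And>k. w k = \<alpha> k / (sqrt C + \<alpha> k)"
    and "\<And>k. \<beta> k = (sqrt C - 1) / (sqrt C + 1 + (real k + 1) / 2)"
    and "\<And>k. \<gamma> k = real k / (2 * sqrt C + real k + 3)"
    and "\<And>k. y k = (1 - w k) *\<^sub>R x k + w k *\<^sub>R v k"
  shows "(\<forall>k. w k = 1 / (sqrt C + 1 + real k / 2)) \<and>
    ((\<forall>k. x (Suc k) - x k
             = w k *\<^sub>R (v k - x k) - \<alpha> k *\<^sub>R (grad f (y k) /\<^sub>R L) \<and>
           v (Suc k) - v k
             = w k *\<^sub>R (x k - v k) - (sqrt C * \<alpha> k) *\<^sub>R (grad f (y k) /\<^sub>R L))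
     \<longleftrightarrow>
     (\<forall>k. x (Suc k) = y k - (\<alpha> k / L) *\<^sub>R grad f (y k) \<and>
           y (Suc k) = x (Suc k) + \<beta> k *\<^sub>R (x (Suc k) - x k) + \<gamma> k *\<^sub>R (y k - x k)))"
proof -
  define s where "s = sqrt C"
  have "0 < \<mu>"
    using assms(2) by (simp add: strongly_convex_def)
  moreover have "\<mu> \<le> L"
    using assms(2,3) by (rule strongly_convex_L_smooth_le)
  ultimately have s: "0 < s"
    by (simp add: s_def assms(4))
  have pos: "0 < s + 1 + real k / 2" for k
    using s by (simp add: add_pos_nonneg)
  have w: "w k = 1 / (s + 1 + real k / 2)" for k
  proof -
    have "0 < s + real k / 2" using s by (simp add: add_pos_nonneg)
    \<comment> \<open>This is the claim cross-multiplied; it rests on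
      \<open>\<alpha> k * (s + real k / 2) = s\<close>.\<close>
    moreover from this s have "\<alpha> k * (s + 1 + real k / 2) = s + \<alpha> k"
      unfolding assms(5) s_def[symmetric] by (simp add: field_simps)
    moreover have "0 < \<alpha> k"
      using s \<open>0 < s + real k / 2\<close> by (simp add: assms(5) s_def[symmetric])
    ultimately show ?thesis
      using s pos[of k] unfolding assms(6) s_def[symmetric] by (simp add: frac_eq_eq)
  qed
  have \<beta>: "\<beta> k = w (Suc k) * (s - 1)" for k
    unfolding assms(7) w s_def[symmetric] by (simp add: add_ac)
  have \<gamma>: "\<gamma> k = w (Suc k) * (real k / 2)" for k
  proof -
    have "2 * s + real k + 3 = 2 * (s + 1 + real (Suc k) / 2)"
      by (simp add: field_simps)
    then show ?thesis
      unfolding assms(8) w s_def[symmetric] by simp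
  qed
  have step: "(x (Suc k) - x k
             = w k *\<^sub>R (v k - x k) - \<alpha> k *\<^sub>R (grad f (y k) /\<^sub>R L) \<and>
           v (Suc k) - v k
             = w k *\<^sub>R (x k - v k) - (sqrt C * \<alpha> k) *\<^sub>R (grad f (y k) /\<^sub>R L))
     \<longleftrightarrow>
     (x (Suc k) = y k - (\<alpha> k / L) *\<^sub>R grad f (y k) \<and>
           y (Suc k) = x (Suc k) + \<beta> k *\<^sub>R (x (Suc k) - x k) + \<gamma> k *\<^sub>R (y k - x k))"
    for k
  proof -
    define d where "d = (\<alpha> k / L) *\<^sub>R grad f (y k)"
    have d: "\<alpha> k *\<^sub>R (grad f (y k) /\<^sub>R L) = d"
        "(sqrt C * \<alpha> k) *\<^sub>R (grad f (y k) /\<^sub>R L) = s *\<^sub>R d"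
      by (simp_all add: d_def s_def divide_inverse)
    have "y k - x k = w k *\<^sub>R (v k - x k)"
      unfolding assms(9)[of k] by (simp add: algebra_simps)
    then have x_iff: "x (Suc k) - x k = w k *\<^sub>R (v k - x k) - d \<longleftrightarrow> x (Suc k) = y k - d"
      by (simp only: diff_eq_eq flip: \<open>y k - x k = _\<close>) (simp add: algebra_simps)
    have v_iff: "v (Suc k) - v k = w k *\<^sub>R (x k - v k) - s *\<^sub>R d \<longleftrightarrow>
        y (Suc k) = x (Suc k) + \<beta> k *\<^sub>R (x (Suc k) - x k) + \<gamma> k *\<^sub>R (y k - x k)"
      \<comment> \<open>Assuming the x-update is harmless: it is, up to \<open>x_iff\<close>, a
        conjunct on both sides.\<close>
      if x': "x (Suc k) = y k - d"
    proof -
      have "w k * (s + 1 + real k / 2) = 1"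
        using pos[of k] by (simp add: w)
      from momentum_residual[OF this assms(9) assms(9)[of "Suc k"] x']
      have "y (Suc k) - (x (Suc k) + \<beta> k *\<^sub>R (x (Suc k) - x k) + \<gamma> k *\<^sub>R (y k - x k))
          = w (Suc k) *\<^sub>R ((v (Suc k) - v k) - (w k *\<^sub>R (x k - v k) - s *\<^sub>R d))"
        unfolding \<beta> \<gamma> .
      \<comment> \<open>Cancelling this factor gives the direction from the y-equation back to the
        v-equation.\<close>
      moreover have "w (Suc k) \<noteq> 0"
        using pos[of "Suc k"] unfolding w by simp
      ultimately show ?thesis
        by (simp only: eq_iff_diff_eq_0[of "y (Suc k)"] eq_iff_diff_eq_0[of "v (Suc k) - v k"]
            scaleR_eq_0_iff simp_thms)
    qed
    show ?thesis
      unfolding d d_def[symmetric] using x_iff v_iff by blast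
  qed
  show ?thesis
    unfolding step using w by (simp only: s_def simp_thms)
qed

end
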